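(* Let $(M,\varphi,\xi,\eta,g)$ be an almost paracontact metric 3-dimensional Walker manifold. Then the following assertions are equivalent: (i) $Q\circ\varphi=\varphi\circ Q$, where $Q$ is the Ricci operator; (ii) $M$ is either flat, or $M$ is $\eta$-Einstein; (iii) the curvature tensor $R$ is a Kähler tensor, i.e. $R(X,Y)\varphi Z=\varphi R(X,Y)Z$ for all vector fields $X,Y,Z$; (iv) the Ricci tensor $\rho$ satisfies $\rho(\varphi X,\varphi Y)=-\rho(X,Y)$ for all $X,Y$; (v) the curvature tensor $R$ satisfies $R(X,Y)\xi=0$ for all $X,Y$.
   Context: An almost paracontact metric 3-dimensional Walker manifold $(M,\varphi,\xi,\eta,g)$ is a 3-manifold with coordinates $(x,y,z)$, $f\in C^\infty(M)$, and, with respect to $\{\partial_x,\partial_y,\partial_z\}$, $$g=\begin{pmatrix}0&0&1\\0&1&0\\1&0&f\end{pmatrix},\quad \varphi=\begin{pmatrix}-\xi_2&\xi_1+f\xi_3&-f\xi_2\\ \xi_3&0&-\xi_1\\0&-\xi_3&\xi_2\end{pmatrix},$$ $\xi=\xi_1\partial_x+\xi_2\partial_y+\xi_3\partial_z$, $\eta=\xi_3dx+\xi_2dy+(\xi_1+f\xi_3)dz$, where $\xi_1,\xi_2,\xi_3\in C^\infty(M)$ satisfy $\xi_2^2+f\xi_3^2+2\xi_1\xi_3=1$ (columns of $\varphi$ are the images of the basis vectors). Curvature convention: $R(X,Y)Z=\nabla_{[X,Y]}Z-\nabla_X\nabla_YZ+\nabla_Y\nabla_XZ$ with $\nabla$ the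 Levi-Civita connection. The Ricci tensor $\rho$ and Ricci operator $Q$ ($g(QX,Y)=\rho(X,Y)$) are, with respect to $\{\partial_x,\partial_y,\partial_z\}$, $$\rho=\tfrac12\begin{pmatrix}0&0&f_{xx}\\ 0&0&f_{xy}\\ f_{xx}&f_{xy}&ff_{xx}-f_{yy}\end{pmatrix},\qquad Q=\tfrac12\begin{pmatrix}f_{xx}&f_{xy}&-f_{yy}\\0&0&f_{xy}\\0&0&f_{xx}\end{pmatrix}.$$ $M$ is $\eta$-Einstein if there exist two smooth functions $a,b$ on $M$ such that $\rho=ag+b\,\eta\otimes\eta$. *)

theory Defs
  imports "HOL-Analysis.Analysis"
begin

text \<open>
  Geometry on an open subset of coordinate space: points, vectors and covectors are elements of
  \<open>real^'n\<close>, a vector field is a function \<open>X\<close> with \<open>X p $ i\<close> its \<open>i\<close>-th component in the coordinate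
  frame, and (0,2)- and (1,1)-tensor fields are matrix-valued functions with respect to that frame.
  Only the values of fields on the (open) underlying set matter.
\<close>

type_synonym 'n vfield = "(real, 'n) vec \<Rightarrow> (real, 'n) vec"
type_synonym 'n mfield = "(real, 'n) vec \<Rightarrow> ((real, 'n) vec, 'n) vec"

section \<open>Smooth functions\<close>

primrec Ck_on :: "nat \<Rightarrow> 'a::real_normed_vector set \<Rightarrow> ('a \<Rightarrow> 'b::real_normed_vector) \<Rightarrow> bool" where
  "Ck_on 0 S h \<longleftrightarrow> continuous_on S h"
| "Ck_on (Suc k) S h \<longleftrightarrow>
     (\<forall>p\<in>S. h differentiable (at p)) \<and> (\<forall>v. Ck_on k S (\<lambda>p. frechet_derivative h (at p) v))"

text \<open>To be used for open sets only, since the derivatives are taken in the whole space.\<close>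

definition smooth_on :: "'a::real_normed_vector set \<Rightarrow> ('a \<Rightarrow> 'b::real_normed_vector) \<Rightarrow> bool" where
  "smooth_on S h \<longleftrightarrow> (\<forall>k. Ck_on k S h)"

section \<open>Levi-Civita connection and curvature\<close>

definition partial :: "'n::finite \<Rightarrow> (real^'n \<Rightarrow> real) \<Rightarrow> real^'n \<Rightarrow> real" where
  "partial i h p = frechet_derivative h (at p) (axis i 1)"

definition coord_field :: "'n::finite \<Rightarrow> 'n vfield" where
  "coord_field i = (\<lambda>p. axis i 1)"

definition inner_of :: "real^'n^'n \<Rightarrow> real^'n \<Rightarrow> real^'n \<Rightarrow> real" where
  "inner_of A u v = u \<bullet> (A *v v)"

definition lie_bracket :: "('n::finite) vfield \<Rightarrow> 'n vfield \<Rightarrow> 'n vfield" where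
  "lie_bracket X Y =
     (\<lambda>p. frechet_derivative Y (at p) (X p) - frechet_derivative X (at p) (Y p))"

text \<open>\<open>christoffel g k i j\<close> is \<open>\<Gamma>\<close> with upper index \<open>k\<close> and lower indices \<open>i\<close>, \<open>j\<close>.\<close>

definition christoffel :: "('n::finite) mfield \<Rightarrow> 'n \<Rightarrow> 'n \<Rightarrow> 'n \<Rightarrow> real^'n \<Rightarrow> real" where
  "christoffel g k i j p =
     (\<Sum>l\<in>UNIV. matrix_inv (g p) $ k $ l *
        (partial i (\<lambda>q. g q $ j $ l) p + partial j (\<lambda>q. g q $ i $ l) p
          - partial l (\<lambda>q. g q $ i $ j) p)) / 2"

definition levi_civita :: "('n::finite) mfield \<Rightarrow> 'n vfield \<Rightarrow> 'n vfield \<Rightarrow> 'n vfield" where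
  "levi_civita g X Y =
     (\<lambda>p. frechet_derivative Y (at p) (X p)
        + (\<chi> k. \<Sum>i\<in>UNIV. \<Sum>j\<in>UNIV. christoffel g k i j p * X p $ i * Y p $ j))"

text \<open>Note the sign: this is the negative of the more common convention.\<close>

definition curvature :: "('n::finite) mfield \<Rightarrow> 'n vfield \<Rightarrow> 'n vfield \<Rightarrow> 'n vfield \<Rightarrow> 'n vfield" where
  "curvature g X Y Z =
     (\<lambda>p. levi_civita g (lie_bracket X Y) Z p
        - levi_civita g X (levi_civita g Y Z) p
        + levi_civita g Y (levi_civita g X Z) p)"

text \<open>
  The Ricci tensor \<open>\<rho>(X,Y)\<close> is the trace of \<open>Z \<mapsto> R(X,Z)Y\<close>, the position of the arguments being the
  one that matches the sign convention for \<open>R\<close>; the trace is taken in the coordinate frame.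
\<close>

definition ricci :: "('n::finite) mfield \<Rightarrow> 'n mfield" where
  "ricci g p = (\<chi> i j. \<Sum>k\<in>UNIV.
     curvature g (coord_field i) (coord_field k) (coord_field j) p $ k)"

definition ricci_operator :: "('n::finite) mfield \<Rightarrow> 'n mfield" where
  "ricci_operator g p =
     (THE Q. \<forall>u v. inner_of (g p) (Q *v u) v = inner_of (ricci g p) u v)"

section \<open>The conditions\<close>

definition flat_on :: "(real^'n::finite) set \<Rightarrow> 'n mfield \<Rightarrow> bool" where
  "flat_on M g \<longleftrightarrow>
     (\<forall>X Y Z. smooth_on M X \<longrightarrow> smooth_on M Y \<longrightarrow> smooth_on M Z \<longrightarrow>
        (\<forall>p\<in>M. curvature g X Y Z p = 0))"

definition eta_einstein :: "(real^'n::finite) set \<Rightarrow> 'n mfield \<Rightarrow> 'n vfield \<Rightarrow> bool" where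
  "eta_einstein M g \<eta> \<longleftrightarrow>
     (\<exists>a b. smooth_on M a \<and> smooth_on M b \<and>
        (\<forall>p\<in>M. ricci g p = a p *\<^sub>R g p + b p *\<^sub>R (\<chi> i j. \<eta> p $ i * \<eta> p $ j)))"

definition ricci_operator_commutes :: "(real^'n::finite) set \<Rightarrow> 'n mfield \<Rightarrow> 'n mfield \<Rightarrow> bool" where
  "ricci_operator_commutes M g \<phi> \<longleftrightarrow>
     (\<forall>p\<in>M. ricci_operator g p ** \<phi> p = \<phi> p ** ricci_operator g p)"

definition kaehler_curvature :: "(real^'n::finite) set \<Rightarrow> 'n mfield \<Rightarrow> 'n mfield \<Rightarrow> bool" where
  "kaehler_curvature M g \<phi> \<longleftrightarrow>
     (\<forall>X Y Z. smooth_on M X \<longrightarrow> smooth_on M Y \<longrightarrow> smooth_on M Z \<longrightarrow>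
        (\<forall>p\<in>M. curvature g X Y (\<lambda>q. \<phi> q *v Z q) p = \<phi> p *v curvature g X Y Z p))"

definition ricci_anti_invariant :: "(real^'n::finite) set \<Rightarrow> 'n mfield \<Rightarrow> 'n mfield \<Rightarrow> bool" where
  "ricci_anti_invariant M g \<phi> \<longleftrightarrow>
     (\<forall>X Y. smooth_on M X \<longrightarrow> smooth_on M Y \<longrightarrow>
        (\<forall>p\<in>M. inner_of (ricci g p) (\<phi> p *v X p) (\<phi> p *v Y p)
           = - inner_of (ricci g p) (X p) (Y p)))"

definition curvature_annihilates :: "(real^'n::finite) set \<Rightarrow> 'n mfield \<Rightarrow> 'n vfield \<Rightarrow> bool" where
  "curvature_annihilates M g \<xi> \<longleftrightarrow>
     (\<forall>X Y. smooth_on M X \<longrightarrow> smooth_on M Y \<longrightarrow> (\<forall>p\<in>M. curvature g X Y \<xi> p = 0))"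

section \<open>Almost paracontact metric Walker 3-manifolds\<close>

text \<open>
  The coordinates \<open>x, y, z\<close> are the components 1, 2, 3, and they identify the manifold with an open
  subset \<open>M\<close> of \<open>real^3\<close>. The matrices below are written row by row; the columns of \<open>walker_phi\<close> are
  the images of the coordinate vectors.
\<close>

definition walker_metric :: "(real^3 \<Rightarrow> real) \<Rightarrow> 3 mfield" where
  "walker_metric f p = vector [vector [0, 0, 1], vector [0, 1, 0], vector [1, 0, f p]]"

definition walker_phi :: "(real^3 \<Rightarrow> real) \<Rightarrow> 3 vfield \<Rightarrow> 3 mfield" where
  "walker_phi f \<xi> p = vector
     [vector [- \<xi> p $ 2, \<xi> p $ 1 + f p * \<xi> p $ 3, - f p * \<xi> p $ 2],
      vector [\<xi> p $ 3, 0, - \<xi> p $ 1],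
      vector [0, - \<xi> p $ 3, \<xi> p $ 2]]"

definition walker_eta :: "(real^3 \<Rightarrow> real) \<Rightarrow> 3 vfield \<Rightarrow> 3 vfield" where
  "walker_eta f \<xi> p = vector [\<xi> p $ 3, \<xi> p $ 2, \<xi> p $ 1 + f p * \<xi> p $ 3]"

definition paracontact_walker :: "(real^3) set \<Rightarrow> (real^3 \<Rightarrow> real) \<Rightarrow> 3 vfield \<Rightarrow> bool" where
  "paracontact_walker M f \<xi> \<longleftrightarrow>
     open M \<and> smooth_on M f \<and> (\<forall>i. smooth_on M (\<lambda>p. \<xi> p $ i)) \<and>
     (\<forall>p\<in>M. (\<xi> p $ 2)\<^sup>2 + f p * (\<xi> p $ 3)\<^sup>2 + 2 * \<xi> p $ 1 * \<xi> p $ 3 = 1)"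

section \<open>Consistency of the definitions\<close>

text \<open>\<open>levi_civita\<close> is torsion-free and metric.\<close>

lemma has_derivative_nth: "(h has_derivative h') F \<Longrightarrow> ((\<lambda>q. h q $ i) has_derivative (\<lambda>v. h' v $ i)) F"
  by (rule bounded_linear.has_derivative[OF bounded_linear_vec_nth])

lemma levi_civita_torsion_free:
  assumes "\<And>q. transpose (g q) = g q"
  shows "levi_civita g X Y p - levi_civita g Y X p = lie_bracket X Y p"
proof -
  have s: "g q $ i $ j = g q $ j $ i" for q i j
    by (subst assms[symmetric]) (simp add: transpose_def)
  have c: "christoffel g k i j p = christoffel g k j i p" for k i j
  proof -
    have e: "partial l (\<lambda>q. g q $ i $ j) p = partial l (\<lambda>q. g q $ j $ i) p" for l
      by (rule arg_cong[where f = "\<lambda>h. partial l h p"], rule ext, rule s)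
    show ?thesis unfolding christoffel_def
      by (rule arg_cong[where f = "\<lambda>x. x / 2"], rule sum.cong[OF refl], subst e, rule arg_cong) simp
  qed
  have "(\<Sum>i\<in>UNIV. \<Sum>j\<in>UNIV. christoffel g k i j p * X p $ i * Y p $ j)
      = (\<Sum>i\<in>UNIV. \<Sum>j\<in>UNIV. christoffel g k i j p * Y p $ i * X p $ j)" for k
  proof -
    have "christoffel g k i j p * X p $ i * Y p $ j = christoffel g k j i p * Y p $ j * X p $ i" for i j
      using c[of k i j] by simp
    then show ?thesis by (simp only:) (rule sum.swap)
  qed
  then show ?thesis by (simp add: levi_civita_def lie_bracket_def)
qed

lemma levi_civita_metric:
  fixes g :: "('n::finite) mfield"
  assumes sym: "\<And>q. transpose (g q) = g q" and inv: "invertible (g p)"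
    and g: "g differentiable (at p)" and Y: "Y differentiable (at p)" and Z: "Z differentiable (at p)"
  shows "frechet_derivative (\<lambda>q. inner_of (g q) (Y q) (Z q)) (at p) (X p) =
           inner_of (g p) (levi_civita g X Y p) (Z p) + inner_of (g p) (Y p) (levi_civita g X Z p)"
proof -
  have s: "g q $ i $ j = g q $ j $ i" for q i j
    by (subst sym[symmetric]) (simp add: transpose_def)
  define G where "G = frechet_derivative g (at p)"
  define DY where "DY = frechet_derivative Y (at p)"
  define DZ where "DZ = frechet_derivative Z (at p)"
  have hg: "(g has_derivative G) (at p)" and hY: "(Y has_derivative DY) (at p)"
    and hZ: "(Z has_derivative DZ) (at p)"
    using g Y Z frechet_derivative_works unfolding G_def DY_def DZ_def by blast+
  have hgij: "((\<lambda>q. g q $ i $ j) has_derivative (\<lambda>v. G v $ i $ j)) (at p)" for i j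
    by (intro has_derivative_nth hg)
  have lin: "linear G" using hg has_derivative_linear by blast
  have part: "partial k (\<lambda>q. g q $ i $ j) p = G (axis k 1) $ i $ j" for i j k
    unfolding partial_def frechet_derivative_at[OF hgij, symmetric] by (rule refl)
  have Gx: "G x $ i $ j = (\<Sum>k\<in>UNIV. x $ k * G (axis k 1) $ i $ j)" for x i j
  proof -
    have "G x = G (\<Sum>k\<in>UNIV. x $ k *\<^sub>R axis k 1)"
      by (metis basis_expansion scalar_mult_eq_scaleR)
    also have "\<dots> = (\<Sum>k\<in>UNIV. x $ k *\<^sub>R G (axis k 1))"
      by (simp add: linear_sum[OF lin] linear_scale[OF lin])
    finally show ?thesis by simp
  qed
  have Gs: "G x $ i $ j = G x $ j $ i" for x i j
  proof -
    have "(\<lambda>q. g q $ i $ j) = (\<lambda>q. g q $ j $ i)" by (rule ext, rule s)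
    with hgij[of i j] have "((\<lambda>q. g q $ j $ i) has_derivative (\<lambda>v. G v $ i $ j)) (at p)" by simp
    from has_derivative_unique[OF this hgij[of j i]] show ?thesis by (rule fun_cong)
  qed
  have ii: "g p ** matrix_inv (g p) = mat 1"
    using someI_ex[OF inv[unfolded invertible_def]] unfolding matrix_inv_def by simp
  have low: "(\<Sum>k\<in>UNIV. g p $ l $ k * christoffel g k i j p) =
     (G (axis i 1) $ j $ l + G (axis j 1) $ i $ l - G (axis l 1) $ i $ j) / 2" for l i j
  proof -
    define c where "c m = (G (axis i 1) $ j $ m + G (axis j 1) $ i $ m - G (axis m 1) $ i $ j)/2" for m
    have "(\<Sum>k\<in>UNIV. g p $ l $ k * christoffel g k i j p)
       = (\<Sum>k\<in>UNIV. \<Sum>m\<in>UNIV. g p $ l $ k * matrix_inv (g p) $ k $ m * c m)"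
      unfolding christoffel_def part c_def
      by (simp add: sum_distrib_left sum_divide_distrib mult.assoc)
    also have "\<dots> = (\<Sum>m\<in>UNIV. (g p ** matrix_inv (g p)) $ l $ m * c m)"
      by (subst sum.swap) (simp add: matrix_matrix_mult_def sum_distrib_right)
    also have "\<dots> = c l" unfolding ii mat_def
      by (simp add: if_distrib[of "\<lambda>x. x * _"] cong: if_cong)
    finally show ?thesis unfolding c_def .
  qed
  have E: "inner_of (g q) u v = (\<Sum>i\<in>UNIV. \<Sum>j\<in>UNIV. g q $ i $ j * u $ i * v $ j)" for q u v
    unfolding inner_of_def inner_vec_def matrix_vector_mult_def
    by (simp add: sum_distrib_left mult_ac)
  have L: "((\<lambda>q. inner_of (g q) (Y q) (Z q)) has_derivative
     (\<lambda>v. \<Sum>i\<in>UNIV. \<Sum>j\<in>UNIV. G v $ i $ j * Y p $ i * Z p $ j +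
        g p $ i $ j * DY v $ i * Z p $ j + g p $ i $ j * Y p $ i * DZ v $ j)) (at p)"
    unfolding E
    by (rule derivative_eq_intros has_derivative_nth hgij hY hZ refl)+
       (simp add: algebra_simps)
  define x y z where "x = X p" and "y = Y p" and "z = Z p"
  have LL: "frechet_derivative (\<lambda>q. inner_of (g q) (Y q) (Z q)) (at p) (X p) =
     (\<Sum>i\<in>UNIV. \<Sum>j\<in>UNIV. G x $ i $ j * y $ i * z $ j) + inner_of (g p) (DY x) z + inner_of (g p) y (DZ x)"
    using frechet_derivative_at[OF L, symmetric] unfolding E x_def y_def z_def
    by (simp add: sum.distrib)
  define C where "C u = (\<chi> k. \<Sum>i\<in>UNIV. \<Sum>j\<in>UNIV. christoffel g k i j p * x $ i * u $ j)" for u :: "real^'n"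
  have IC: "inner_of (g p) u (C w) = (\<Sum>l\<in>UNIV. \<Sum>i\<in>UNIV. \<Sum>j\<in>UNIV.
     u $ l * x $ i * w $ j * ((G (axis i 1) $ j $ l + G (axis j 1) $ i $ l - G (axis l 1) $ i $ j) / 2))" for u w
  proof -
    have "inner_of (g p) u (C w) = (\<Sum>l\<in>UNIV. \<Sum>k\<in>UNIV. \<Sum>i\<in>UNIV. \<Sum>j\<in>UNIV.
       u $ l * x $ i * w $ j * (g p $ l $ k * christoffel g k i j p))"
      unfolding E C_def by (simp add: sum_distrib_left mult_ac)
    also have "\<dots> = (\<Sum>l\<in>UNIV. \<Sum>i\<in>UNIV. \<Sum>k\<in>UNIV. \<Sum>j\<in>UNIV.
       u $ l * x $ i * w $ j * (g p $ l $ k * christoffel g k i j p))"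
      by (rule sum.cong[OF refl], rule sum.swap)
    also have "\<dots> = (\<Sum>l\<in>UNIV. \<Sum>i\<in>UNIV. \<Sum>j\<in>UNIV. \<Sum>k\<in>UNIV.
       u $ l * x $ i * w $ j * (g p $ l $ k * christoffel g k i j p))"
      by (rule sum.cong[OF refl], rule sum.cong[OF refl], rule sum.swap)
    also have "\<dots> = (\<Sum>l\<in>UNIV. \<Sum>i\<in>UNIV. \<Sum>j\<in>UNIV.
       u $ l * x $ i * w $ j * (\<Sum>k\<in>UNIV. g p $ l $ k * christoffel g k i j p))"
      by (simp add: sum_distrib_left)
    finally show ?thesis unfolding low .
  qed
  have symI: "inner_of (g p) u w = inner_of (g p) w u" for u w
    unfolding E by (subst sum.swap) (simp add: s mult_ac)
  have addI: "inner_of (g p) (u + u') w = inner_of (g p) u w + inner_of (g p) u' w" 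
     "inner_of (g p) w (u + u') = inner_of (g p) w u + inner_of (g p) w u'" for u u' w
    unfolding inner_of_def by (simp_all add: inner_add_left inner_add_right matrix_vector_right_distrib)
  have "inner_of (g p) z (C y) + inner_of (g p) y (C z) = (\<Sum>i\<in>UNIV. \<Sum>j\<in>UNIV. G x $ i $ j * y $ i * z $ j)"
  proof -
    let ?g = "\<lambda>i j l. (G (axis i 1) $ j $ l + G (axis j 1) $ i $ l - G (axis l 1) $ i $ j) / 2"
    have a: "inner_of (g p) z (C y) = (\<Sum>j\<in>UNIV. \<Sum>l\<in>UNIV. \<Sum>i\<in>UNIV. z $ l * x $ i * y $ j * ?g i j l)"
    proof -
      have "inner_of (g p) z (C y) = (\<Sum>l\<in>UNIV. \<Sum>j\<in>UNIV. \<Sum>i\<in>UNIV. z $ l * x $ i * y $ j * ?g i j l)"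
        unfolding IC by (rule sum.cong[OF refl], rule sum.swap)
      also have "\<dots> = (\<Sum>j\<in>UNIV. \<Sum>l\<in>UNIV. \<Sum>i\<in>UNIV. z $ l * x $ i * y $ j * ?g i j l)"
        by (rule sum.swap)
      finally show ?thesis .
    qed
    have b: "inner_of (g p) y (C z) = (\<Sum>j\<in>UNIV. \<Sum>l\<in>UNIV. \<Sum>i\<in>UNIV. y $ j * x $ i * z $ l * ?g i l j)"
      unfolding IC by (rule sum.cong[OF refl], rule sum.swap)
    have gg: "?g i j l + ?g i l j = G (axis i 1) $ j $ l" for i j l
      using Gs[of "axis i 1" l j] Gs[of "axis l 1" i j] Gs[of "axis j 1" i l] by (simp add: field_simps)
    have "z $ l * x $ i * y $ j * ?g i j l + y $ j * x $ i * z $ l * ?g i l j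
        = x $ i * G (axis i 1) $ j $ l * y $ j * z $ l" for i j l
      by (subst gg[symmetric]) (simp only: algebra_simps)
    then have "inner_of (g p) z (C y) + inner_of (g p) y (C z) =
        (\<Sum>j\<in>UNIV. \<Sum>l\<in>UNIV. \<Sum>i\<in>UNIV. x $ i * G (axis i 1) $ j $ l * y $ j * z $ l)"
      unfolding a b by (simp only: sum.distrib[symmetric])
    then show ?thesis by (simp add: Gx[of x] sum_distrib_right)
  qed
  moreover have "levi_civita g X Y p = DY x + C y" "levi_civita g X Z p = DZ x + C z"
    by (simp_all add: levi_civita_def DY_def DZ_def x_def C_def y_def z_def)
  ultimately show ?thesis
    unfolding LL by (simp add: addI symI[of _ z] x_def[symmetric] y_def[symmetric] z_def[symmetric])
qed


text \<open>
  In the Walker case, \<open>ricci\<close> and \<open>ricci_operator\<close> have the expected coordinate expressions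
  (\<open>walker_ricci\<close> and \<open>walker_ricci_operator\<close> below), given equality of mixed partial derivatives.
\<close>

lemma walker_metric_inv: "matrix_inv (walker_metric f p) = vector [vector [- f p, 0, 1], vector [0, 1, 0], vector [1, 0, 0]]" (is "_ = ?B")
proof -
  let ?A = "walker_metric f p"
  have ab: "?A ** ?B = mat 1" "?B ** ?A = mat 1"
    by (auto simp: vec_eq_iff matrix_matrix_mult_def mat_def walker_metric_def forall_3 sum_3)
  have "?A ** matrix_inv ?A = mat 1 \<and> matrix_inv ?A ** ?A = mat 1"
    unfolding matrix_inv_def by (rule someI[of _ ?B]) (use ab in simp)
  then have "?B ** (?A ** matrix_inv ?A) = ?B" by simp
  then show ?thesis unfolding matrix_mul_assoc ab by simp
qed

lemma partial_const: "partial k (\<lambda>q. c) p = 0"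
  unfolding partial_def by simp

lemma christoffel_walker: 
 "christoffel (walker_metric f) k i j p =
   (if k = 1 then (if (i,j) = (1,3) \<or> (i,j) = (3,1) then partial 1 f p / 2
      else if (i,j) = (2,3) \<or> (i,j) = (3,2) then partial 2 f p / 2
      else if (i,j) = (3,3) then (f p * partial 1 f p + partial 3 f p) / 2 else 0)
    else if (i,j) = (3,3) then (if k = 2 then - partial 2 f p / 2 else - partial 1 f p / 2) else 0)"
proof -
  have P: "partial l (\<lambda>q. walker_metric f q $ i $ j) p = (if i = 3 \<and> j = 3 then partial l f p else 0)"
    for l i j :: 3
    using exhaust_3[of i] exhaust_3[of j] by (auto simp: walker_metric_def partial_const)
  show ?thesis
    unfolding christoffel_def P walker_metric_inv sum_3
    using exhaust_3[of k] exhaust_3[of i] exhaust_3[of j] by (elim disjE) (simp_all add: add_divide_distrib)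
qed

lemma levi_civita_coord: "levi_civita g (coord_field i) (coord_field j) = (\<lambda>p. \<chi> k. christoffel g k i j p)"
  unfolding levi_civita_def coord_field_def
  by (auto simp: fun_eq_iff vec_eq_iff axis_def if_distrib[of "\<lambda>x. _ * x"] cong: if_cong)

lemma lie_bracket_coord: "lie_bracket (coord_field i) (coord_field j) = (\<lambda>p. 0)"
  unfolding lie_bracket_def coord_field_def by simp

lemma frechet_derivative_vec: "frechet_derivative (\<lambda>p. \<chi> k. c k p) (at p) v $ k = frechet_derivative (c k) (at p) v"
  if "\<And>k. c k differentiable (at p)" for c :: "'n::finite \<Rightarrow> real^'n \<Rightarrow> real"
proof -
  have h: "(c k has_derivative frechet_derivative (c k) (at p)) (at p)" for k
    using that frechet_derivative_works by blast
  have "((\<lambda>p. \<chi> k. c k p) has_derivative (\<lambda>v. \<chi> k. frechet_derivative (c k) (at p) v)) (at p)"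
    unfolding has_derivative_componentwise_within[of "\<lambda>p. \<chi> k. c k p"]
    using h by (auto simp: Basis_vec_def inner_axis)
  from frechet_derivative_at[OF this, symmetric] show ?thesis by simp
qed

lemma curvature_coord: 
  assumes "\<And>k i j. christoffel g k i j differentiable (at p)"
  shows "curvature g (coord_field i) (coord_field k) (coord_field j) p $ l =
   - (partial i (christoffel g l k j) p + (\<Sum>m\<in>UNIV. christoffel g l i m p * christoffel g m k j p))
   + (partial k (christoffel g l i j) p + (\<Sum>m\<in>UNIV. christoffel g l k m p * christoffel g m i j p))"
proof -
  have A: "levi_civita g (coord_field i) (\<lambda>p. \<chi> k. christoffel g k a b p) p $ l =
     partial i (christoffel g l a b) p + (\<Sum>m\<in>UNIV. christoffel g l i m p * christoffel g m a b p)" for i a b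
    unfolding levi_civita_def
    by (simp add: frechet_derivative_vec assms coord_field_def partial_def axis_def)
     (simp add: if_distrib[of "\<lambda>x. _ * x"] if_distrib[of "\<lambda>x. x * _"] sum.swap[of _ UNIV UNIV] cong: if_cong)
  have B: "levi_civita g (\<lambda>p. 0) (coord_field j) p $ l = 0"
    unfolding levi_civita_def by (simp add: coord_field_def)
  show ?thesis unfolding curvature_def lie_bracket_coord levi_civita_coord by (simp add: A B)
qed

lemma partial_minus: "h differentiable (at p) \<Longrightarrow> partial k (\<lambda>q. - h q) p = - partial k h p"
  and partial_half: "h differentiable (at p) \<Longrightarrow> partial k (\<lambda>q. h q / 2) p = partial k h p / 2"
  and partial_mult: "h differentiable (at p) \<Longrightarrow> h' differentiable (at p) \<Longrightarrow> partial k (\<lambda>q. h q * h' q) p = h p * partial k h' p + partial k h p * h' p"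
  and partial_add: "h differentiable (at p) \<Longrightarrow> h' differentiable (at p) \<Longrightarrow> partial k (\<lambda>q. h q + h' q) p = partial k h p + partial k h' p"
proof -
  assume h: "h differentiable (at p)"
  then have H: "(h has_derivative frechet_derivative h (at p)) (at p)" using frechet_derivative_works by blast
  show "partial k (\<lambda>q. - h q) p = - partial k h p"
    unfolding partial_def using frechet_derivative_at[OF has_derivative_minus[OF H]] by metis
  have "((\<lambda>q. h q / 2) has_derivative (\<lambda>v. frechet_derivative h (at p) v / 2)) (at p)"
    using bounded_linear.has_derivative[OF bounded_linear_divide H] by simp
  from frechet_derivative_at[OF this] show "partial k (\<lambda>q. h q / 2) p = partial k h p / 2"
    unfolding partial_def by metis
  assume "h' differentiable (at p)"
  then have H': "(h' has_derivative frechet_derivative h' (at p)) (at p)" using frechet_derivative_works by blast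
  show "partial k (\<lambda>q. h q * h' q) p = h p * partial k h' p + partial k h p * h' p"
    unfolding partial_def using frechet_derivative_at[OF has_derivative_mult[OF H H']] by metis
  show "partial k (\<lambda>q. h q + h' q) p = partial k h p + partial k h' p"
    unfolding partial_def using frechet_derivative_at[OF has_derivative_add[OF H H']] by metis
qed

lemma walker_ricci:
  assumes f: "f differentiable (at p)" and p: "\<And>i. partial i f differentiable (at p)"
   and s: "\<And>i j. partial i (partial j f) p = partial j (partial i f) p"
  shows "ricci (walker_metric f) p = (let fxx = partial 1 (partial 1 f) p; fxy = partial 1 (partial 2 f) p;
     fyy = partial 2 (partial 2 f) p in
     (1/2) *\<^sub>R vector [vector [0,0,fxx], vector [0,0,fxy], vector [fxx, fxy, f p * fxx - fyy]])"
proof -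
  have C: "christoffel (walker_metric f) k i j = (\<lambda>p. 
   (if k = 1 then (if (i,j) = (1,3) \<or> (i,j) = (3,1) then partial 1 f p / 2
      else if (i,j) = (2,3) \<or> (i,j) = (3,2) then partial 2 f p / 2
      else if (i,j) = (3,3) then (f p * partial 1 f p + partial 3 f p) / 2 else 0)
    else if (i,j) = (3,3) then (if k = 2 then - partial 2 f p / 2 else - partial 1 f p / 2) else 0))" for k i j
    by (rule ext, rule christoffel_walker)
  have D: "christoffel (walker_metric f) k i j differentiable (at p)" for k i j
    using exhaust_3[of k] exhaust_3[of i] exhaust_3[of j] unfolding C
    by (elim disjE) (simp_all add: f p differentiable_mult differentiable_add differentiable_minus differentiable_divide)
  show ?thesis
    unfolding ricci_def Let_def curvature_coord[OF D] C
    apply (simp add: vec_eq_iff forall_3 sum_3 partial_const)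
    apply (simp add: partial_minus partial_half partial_mult partial_add f p differentiable_mult differentiable_add differentiable_minus differentiable_divide s[of 3 1] s[of 2 1])
    by (auto simp: algebra_simps divide_simps)
qed

lemma ricci_operator_inv:
  assumes "transpose (ricci (walker_metric f) p) = ricci (walker_metric f) p"
  shows "ricci_operator (walker_metric f) p = matrix_inv (walker_metric f p) ** ricci (walker_metric f) p"
proof -
  define A where "A = walker_metric f p"
  define B where "B = matrix_inv (walker_metric f p)"
  define r where "r = ricci (walker_metric f) p"
  have AB: "A ** B = mat 1" "B ** A = mat 1"
    unfolding A_def B_def walker_metric_inv
    by (auto simp: vec_eq_iff matrix_matrix_mult_def mat_def walker_metric_def forall_3 sum_3)
  have tA: "transpose A = A"
    by (auto simp: A_def vec_eq_iff transpose_def walker_metric_def forall_3)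
  have tr: "transpose r = r" using assms by (simp add: r_def)
  have E: "inner_of A (Q *v u) v = inner_of r u v \<longleftrightarrow> ((A ** Q - r) *v u) \<bullet> v = 0" for Q u v
  proof -
    have "inner_of A (Q *v u) v = (A *v (Q *v u)) \<bullet> v"
      unfolding inner_of_def by (metis dot_lmul_matrix tA transpose_matrix_vector)
    moreover have "inner_of r u v = (r *v u) \<bullet> v"
      unfolding inner_of_def by (metis dot_lmul_matrix tr transpose_matrix_vector)
    ultimately show ?thesis by (simp add: matrix_vector_mul_assoc matrix_vector_mult_diff_rdistrib inner_diff_left)
  qed
  have "(\<forall>u v. inner_of A (Q *v u) v = inner_of r u v) \<longleftrightarrow> A ** Q = r" for Q
    unfolding E by (metis (no_types) eq_iff_diff_eq_0 inner_eq_zero_iff inner_zero_left matrix_eq matrix_vector_mult_0)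
  moreover have "A ** Q = r \<longleftrightarrow> Q = B ** r" for Q
    using AB by (metis matrix_mul_assoc matrix_mul_lid)
  ultimately show ?thesis unfolding ricci_operator_def A_def[symmetric] B_def[symmetric] r_def[symmetric]
    by (simp add: A_def B_def)
qed

lemma walker_ricci_operator:
  assumes f: "f differentiable (at p)" and p: "\<And>i. partial i f differentiable (at p)"
   and s: "\<And>i j. partial i (partial j f) p = partial j (partial i f) p"
  shows "ricci_operator (walker_metric f) p = (let fxx = partial 1 (partial 1 f) p; fxy = partial 1 (partial 2 f) p;
     fyy = partial 2 (partial 2 f) p in
     (1/2) *\<^sub>R vector [vector [fxx,fxy,- fyy], vector [0,0,fxy], vector [0,0,fxx]])"
proof -
  have "transpose (ricci (walker_metric f) p) = ricci (walker_metric f) p"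
    unfolding walker_ricci[OF assms] Let_def by (simp add: vec_eq_iff forall_3 transpose_def)
  from ricci_operator_inv[OF this] show ?thesis unfolding walker_ricci[OF assms] Let_def walker_metric_inv
    by (simp add: vec_eq_iff forall_3 matrix_matrix_mult_def sum_3 diff_divide_distrib)
qed

end

theory Submission
  imports Defs
begin

text \<open>
  The curvature is tensorial, so all five conditions are pointwise and algebraic in
  \<open>fxx\<close>, \<open>fxy\<close>, \<open>fyy\<close> and the components of \<open>\<xi>\<close>. Each of them says that at every point
  \<open>\<xi>\<^sub>3\<close> annihilates \<open>fxx\<close>, \<open>fxy\<close>, \<open>fyy\<close>, while \<open>(\<xi>\<^sub>1, \<xi>\<^sub>2)\<close> is in the kernel of the Hessian of \<open>f\<close>
  in \<open>x, y\<close>: where \<open>\<xi>\<^sub>3 \<noteq> 0\<close> the curvature vanishes, and where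
  \<open>\<xi>\<^sub>3 = 0\<close> the normalisation gives \<open>\<xi>\<^sub>2 = \<plusminus>1\<close>, so that
  \<open>fxy\<close> and \<open>fyy\<close> are determined by \<open>fxx\<close>. Flatness is the case in which all three vanish,
  and it already implies the \<open>\<eta>\<close>-Einstein condition with \<open>a = b = 0\<close>.
\<close>

section \<open>Symmetry of second derivatives\<close>

text \<open>The mean value theorem in direction \<open>u\<close>, applied to the difference in
  direction \<open>v\<close>, turns the second difference into \<open>t\<close> times an increment
  of the derivative along \<open>u\<close>. Differentiability of that derivative at the point
  \<open>p\<close> then gives the limit.\<close>

lemma second_difference_quotient_tendsto:
  fixes h :: "'a::real_normed_vector \<Rightarrow> real"
  assumes "open M" "p \<in> M" and h: "\<And>q. q \<in> M \<Longrightarrow> h differentiable (at q)"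
    and L: "((\<lambda>q. frechet_derivative h (at q) u) has_derivative L) (at p)"
  shows "((\<lambda>t. (h (p + t *\<^sub>R u + t *\<^sub>R v) - h (p + t *\<^sub>R u) - h (p + t *\<^sub>R v) + h p) / t\<^sup>2)
           \<longlongrightarrow> L v) (at_right 0)"
proof (rule tendstoI)
  fix e :: real assume "e > 0"
  \<comment> \<open>The summand 1 keeps \<open>N\<close> positive when \<open>u\<close> and
    \<open>v\<close> both vanish.\<close>
  define N where "N = norm u + norm v + 1"
  have N: "N > 0" "norm u \<le> N" "norm v \<le> N" "norm u + norm v \<le> N" by (auto simp: N_def add_nonneg_pos)
  \<comment> \<open>The linear approximation is used at two points, each with error at most
    \<open>e' * (t * N)\<close>. After division by \<open>t\<close> they add up to
    \<open>e / 2\<close>.\<close>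
  define e' where "e' = e / (4 * N)"
  have e': "e' > 0" using \<open>e > 0\<close> N by (simp add: e'_def)
  define H where "H q = frechet_derivative h (at q) u" for q
  have linL: "linear L" using L has_derivative_linear by blast
  obtain d where d: "d > 0" "\<And>y. norm (y - p) < d \<Longrightarrow> norm (H y - H p - L (y - p)) \<le> e' * norm (y - p)"
    using L e' unfolding has_derivative_at_alt H_def by blast
  obtain r where r: "r > 0" "ball p r \<subseteq> M" using assms(1,2) openE by blast
  \<comment> \<open>For \<open>t < \<delta>\<close> the whole parallelogram spanned by
    \<open>t *\<^sub>R u\<close> and \<open>t *\<^sub>R v\<close> at \<open>p\<close> lies in
    \<open>M\<close> and within the range \<open>d\<close> of the linear approximation.\<close>
  define \<delta> where "\<delta> = min d r / N"
  have "\<delta> > 0" using d r N by (simp add: \<delta>_def)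
  show "\<forall>\<^sub>F t in at_right 0.
      dist ((h (p + t *\<^sub>R u + t *\<^sub>R v) - h (p + t *\<^sub>R u) - h (p + t *\<^sub>R v) + h p) / t\<^sup>2) (L v) < e"
    unfolding eventually_at_right_field
  proof (intro exI[of _ \<delta>] conjI allI impI \<open>\<delta> > 0\<close>)
    fix t :: real assume t: "t > 0" "t < \<delta>"
    have tN: "t * N < min d r" using t N by (simp add: \<delta>_def pos_less_divide_eq)
    have small: "norm (s *\<^sub>R u + s' *\<^sub>R v) \<le> t * N" if "0 \<le> s" "s \<le> t" "0 \<le> s'" "s' \<le> t" for s s'
    proof -
      have "norm (s *\<^sub>R u + s' *\<^sub>R v) \<le> s * norm u + s' * norm v"
        using norm_triangle_ineq[of "s *\<^sub>R u" "s' *\<^sub>R v"] that by simp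
      also have "\<dots> \<le> t * norm u + t * norm v" using that by (intro add_mono mult_right_mono) auto
      also have "\<dots> \<le> t * N" using N(4) t by (simp add: distrib_left[symmetric])
      finally show ?thesis .
    qed
    have inM: "p + (s *\<^sub>R u + s' *\<^sub>R v) \<in> M" if "0 \<le> s" "s \<le> t" "0 \<le> s'" "s' \<le> t" for s s'
      using small[OF that] tN norm_minus_cancel[of "s *\<^sub>R u + s' *\<^sub>R v"]
      by (intro subsetD[OF r(2)]) (simp add: dist_norm)
    \<comment> \<open>The term \<open>0 *\<^sub>R v\<close> is kept so that both summands are
      instances of \<open>line\<close>, with \<open>s' = t\<close> and
      \<open>s' = 0\<close>.\<close>
    define \<psi> where "\<psi> s = h (p + (s *\<^sub>R u + t *\<^sub>R v)) - h (p + (s *\<^sub>R u + 0 *\<^sub>R v))" for s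
    have line: "((\<lambda>s. h (p + (s *\<^sub>R u + s' *\<^sub>R v))) has_real_derivative H (p + (s *\<^sub>R u + s' *\<^sub>R v))) (at s)"
      if "0 \<le> s" "s \<le> t" "0 \<le> s'" "s' \<le> t" for s s'
    proof -
      let ?q = "p + (s *\<^sub>R u + s' *\<^sub>R v)"
      have D: "(h has_derivative frechet_derivative h (at ?q)) (at ?q)"
        using h[OF inM[OF that]] frechet_derivative_works by blast
      have "((\<lambda>s. p + (s *\<^sub>R u + s' *\<^sub>R v)) has_derivative (\<lambda>x. x *\<^sub>R u)) (at s)"
        by (auto intro!: derivative_eq_intros)
      from has_derivative_compose[OF this D] show ?thesis
        unfolding has_field_derivative_def H_def
        by (simp add: linear_scale[OF has_derivative_linear[OF D]] mult.commute[of _ "frechet_derivative h _ _"])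
    qed
    have "\<exists>s>0. s < t \<and> \<psi> t - \<psi> 0 =
        (t - 0) * (H (p + (s *\<^sub>R u + t *\<^sub>R v)) - H (p + (s *\<^sub>R u + 0 *\<^sub>R v)))"
      using t unfolding \<psi>_def by (intro MVT2 DERIV_diff line) auto
    then obtain s where s: "0 < s" "s < t" and
      E: "\<psi> t - \<psi> 0 = t * (H (p + (s *\<^sub>R u + t *\<^sub>R v)) - H (p + (s *\<^sub>R u + 0 *\<^sub>R v)))" by auto
    have b: "\<bar>H (p + (s *\<^sub>R u + s' *\<^sub>R v)) - H p - L (s *\<^sub>R u + s' *\<^sub>R v)\<bar> \<le> e' * (t * N)"
      if "0 \<le> s'" "s' \<le> t" for s'
    proof -
      have n: "norm (s *\<^sub>R u + s' *\<^sub>R v) \<le> t * N" using small that s by simp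
      have "\<bar>H (p + (s *\<^sub>R u + s' *\<^sub>R v)) - H p - L (s *\<^sub>R u + s' *\<^sub>R v)\<bar> \<le> e' * norm (s *\<^sub>R u + s' *\<^sub>R v)"
        using d(2)[of "p + (s *\<^sub>R u + s' *\<^sub>R v)"] n tN by simp
      also have "\<dots> \<le> e' * (t * N)" using n e' by simp
      finally show ?thesis .
    qed
    have LL: "L (s *\<^sub>R u + t *\<^sub>R v) - L (s *\<^sub>R u + 0 *\<^sub>R v) = t * L v"
      by (simp add: linear_add[OF linL] linear_scale[OF linL])
    have "\<bar>(\<psi> t - \<psi> 0) / t - t * L v\<bar> \<le> 2 * (e' * (t * N))"
      using b[of t] b[of 0] t LL unfolding E by simp
    then have "\<bar>(\<psi> t - \<psi> 0) / t - t * L v\<bar> / t \<le> 2 * (e' * N)"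
      using t by (simp add: pos_divide_le_eq mult_ac)
    also have "\<dots> < e" using \<open>e > 0\<close> N by (simp add: e'_def)
    also have "\<bar>(\<psi> t - \<psi> 0) / t - t * L v\<bar> / t = \<bar>((\<psi> t - \<psi> 0) / t - t * L v) / t\<bar>"
      using t by simp
    also have "((\<psi> t - \<psi> 0) / t - t * L v) / t = (\<psi> t - \<psi> 0) / t\<^sup>2 - L v"
      using t by (simp add: field_simps power2_eq_square)
    finally show "dist ((h (p + t *\<^sub>R u + t *\<^sub>R v) - h (p + t *\<^sub>R u) - h (p + t *\<^sub>R v) + h p) / t\<^sup>2) (L v) < e"
      by (simp add: \<psi>_def dist_real_def algebra_simps)
  qed
qed

text \<open>The second difference is symmetric in \<open>u\<close> and \<open>v\<close>, and its
  quotient by \<open>t\<^sup>2\<close> converges to either mixed derivative, so the two limits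
  agree.\<close>

lemma second_derivative_symmetric:
  fixes h :: "'a::real_normed_vector \<Rightarrow> real"
  assumes "open M" "p \<in> M" "\<And>q. q \<in> M \<Longrightarrow> h differentiable (at q)"
    and "(\<lambda>q. frechet_derivative h (at q) u) differentiable (at p)"
    and "(\<lambda>q. frechet_derivative h (at q) v) differentiable (at p)"
  shows "frechet_derivative (\<lambda>q. frechet_derivative h (at q) u) (at p) v =
         frechet_derivative (\<lambda>q. frechet_derivative h (at q) v) (at p) u"
proof -
  have u: "((\<lambda>t. (h (p + t *\<^sub>R u + t *\<^sub>R v) - h (p + t *\<^sub>R u) - h (p + t *\<^sub>R v) + h p) / t\<^sup>2) \<longlongrightarrow>
      frechet_derivative (\<lambda>q. frechet_derivative h (at q) u) (at p) v) (at_right 0)"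
    using assms(4) frechet_derivative_works
    by (intro second_difference_quotient_tendsto[OF assms(1-3)]) blast+
  have "((\<lambda>t. (h (p + t *\<^sub>R v + t *\<^sub>R u) - h (p + t *\<^sub>R v) - h (p + t *\<^sub>R u) + h p) / t\<^sup>2) \<longlongrightarrow>
      frechet_derivative (\<lambda>q. frechet_derivative h (at q) v) (at p) u) (at_right 0)"
    using assms(5) frechet_derivative_works
    by (intro second_difference_quotient_tendsto[OF assms(1-3)]) blast+
  then have "((\<lambda>t. (h (p + t *\<^sub>R u + t *\<^sub>R v) - h (p + t *\<^sub>R u) - h (p + t *\<^sub>R v) + h p) / t\<^sup>2) \<longlongrightarrow>
      frechet_derivative (\<lambda>q. frechet_derivative h (at q) v) (at p) u) (at_right 0)"
    by (simp add: algebra_simps)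
  from tendsto_unique[OF _ u this] show ?thesis by simp
qed

section \<open>Twice differentiable functions\<close>

text \<open>Two derivatives are what the curvature of a field involves. At this order closure under
  products takes one use of the product rule for first partials, which suffices to treat
  \<phi>Z.\<close>

definition twice_differentiable_on :: "(real^'n::finite) set \<Rightarrow> (real^'n \<Rightarrow> real) \<Rightarrow> bool" where
  "twice_differentiable_on S h \<longleftrightarrow>
     (\<forall>p\<in>S. h differentiable (at p) \<and> (\<forall>i. partial i h differentiable (at p)))"

lemma partial_symmetric:
  assumes "open S" "p \<in> S" "twice_differentiable_on S h"
  shows "partial i (partial j h) p = partial j (partial i h) p"
proof -
  have e: "partial k h = (\<lambda>q. frechet_derivative h (at q) (axis k 1))" for k
    by (rule ext) (simp add: partial_def)
  have "frechet_derivative (partial j h) (at p) (axis i 1) = frechet_derivative (partial i h) (at p) (axis j 1)"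
    using assms(2,3) unfolding e twice_differentiable_on_def
    by (intro second_derivative_symmetric[OF assms(1,2)]) auto
  then show ?thesis by (simp add: partial_def)
qed

lemma differentiable_transform_open:
  assumes "h differentiable (at p)" "open S" "p \<in> S" "\<And>q. q \<in> S \<Longrightarrow> h q = h' q"
  shows "h' differentiable (at p)"
  using assms has_derivative_transform_within_open unfolding differentiable_def by metis

lemma partial_eq:
  assumes "(h has_derivative h') (at p)"
  shows "partial i h p = h' (axis i 1)"
  unfolding partial_def using frechet_derivative_at[OF assms] by simp

lemma twice_differentiable_on_add:
  assumes "open S" "twice_differentiable_on S h" "twice_differentiable_on S k"
  shows "twice_differentiable_on S (\<lambda>q. h q + k q)"
  unfolding twice_differentiable_on_def
proof (intro ballI conjI allI)
  fix p i assume p: "p \<in> S"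
  show "(\<lambda>q. h q + k q) differentiable at p"
    using assms p by (auto simp: twice_differentiable_on_def)
  have "(\<lambda>q. partial i h q + partial i k q) differentiable at p"
    using assms p by (auto simp: twice_differentiable_on_def)
  then show "partial i (\<lambda>q. h q + k q) differentiable at p"
    by (rule differentiable_transform_open[OF _ assms(1) p])
       (use assms in \<open>auto simp: twice_differentiable_on_def partial_add\<close>)
qed

lemma twice_differentiable_on_mult:
  assumes "open S" "twice_differentiable_on S h" "twice_differentiable_on S k"
  shows "twice_differentiable_on S (\<lambda>q. h q * k q)"
  unfolding twice_differentiable_on_def
proof (intro ballI conjI allI)
  fix p i assume p: "p \<in> S"
  show "(\<lambda>q. h q * k q) differentiable at p"
    using assms p by (auto simp: twice_differentiable_on_def)
  have "(\<lambda>q. h q * partial i k q + partial i h q * k q) differentiable at p"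
    using assms p by (auto simp: twice_differentiable_on_def)
  then show "partial i (\<lambda>q. h q * k q) differentiable at p"
    by (rule differentiable_transform_open[OF _ assms(1) p])
       (use assms in \<open>auto simp: twice_differentiable_on_def partial_mult\<close>)
qed

lemma twice_differentiable_on_const: "twice_differentiable_on S (\<lambda>q. c)"
proof -
  have "partial i (\<lambda>q. c) = (\<lambda>q. 0)" for i :: 'a by (rule ext) (rule partial_const)
  then show ?thesis by (simp add: twice_differentiable_on_def)
qed

lemma twice_differentiable_on_uminus:
  assumes "open S" "twice_differentiable_on S h"
  shows "twice_differentiable_on S (\<lambda>q. - h q)"
  using twice_differentiable_on_mult[OF assms(1) twice_differentiable_on_const[of S "-1"] assms(2)] by simp

lemma twice_differentiable_on_sum:
  assumes "open S" "\<And>k. twice_differentiable_on S (h k)"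
  shows "twice_differentiable_on S (\<lambda>q. \<Sum>k\<in>A. h k q)"
  by (induction A rule: infinite_finite_induct)
     (auto intro: twice_differentiable_on_const twice_differentiable_on_add assms)

lemma smooth_on_imp_twice_differentiable_on:
  assumes "smooth_on S h"
  shows "twice_differentiable_on S h"
proof -
  have "Ck_on 2 S h" using assms by (simp add: smooth_on_def)
  moreover have e: "partial k h = (\<lambda>q. frechet_derivative h (at q) (axis k 1))" for k
    by (rule ext) (simp add: partial_def)
  ultimately show ?thesis by (simp add: numeral_2_eq_2 twice_differentiable_on_def)
qed

section \<open>Componentwise differentiation of vector fields\<close>

lemma has_derivative_vec:
  fixes X :: "'a::real_normed_vector \<Rightarrow> real^'n"
  assumes "\<And>k. ((\<lambda>q. X q $ k) has_derivative (\<lambda>v. D v $ k)) (at p)"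
  shows "(X has_derivative D) (at p)"
  unfolding has_derivative_componentwise_within[of X]
  using assms by (auto simp: Basis_vec_def inner_axis)

lemma differentiable_vec_iff:
  fixes X :: "'a::real_normed_vector \<Rightarrow> real^'n"
  shows "X differentiable (at p) \<longleftrightarrow> (\<forall>k. (\<lambda>q. X q $ k) differentiable (at p))"
proof
  assume "X differentiable (at p)"
  then show "\<forall>k. (\<lambda>q. X q $ k) differentiable (at p)"
    unfolding differentiable_def using has_derivative_nth by blast
next
  assume "\<forall>k. (\<lambda>q. X q $ k) differentiable (at p)"
  then have "((\<lambda>q. X q $ k) has_derivative (\<lambda>v. (\<chi> k. frechet_derivative (\<lambda>q. X q $ k) (at p) v) $ k)) (at p)" for k
    by (simp flip: frechet_derivative_works)
  then show "X differentiable (at p)" unfolding differentiable_def by (intro exI has_derivative_vec)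
qed

lemma frechet_derivative_nth:
  fixes X :: "'a::real_normed_vector \<Rightarrow> real^'n"
  assumes "X differentiable (at p)"
  shows "frechet_derivative X (at p) v $ k = frechet_derivative (\<lambda>q. X q $ k) (at p) v"
proof -
  have "(X has_derivative frechet_derivative X (at p)) (at p)"
    using assms frechet_derivative_works by blast
  from frechet_derivative_at[OF has_derivative_nth[OF this, of k]] show ?thesis by metis
qed

lemma frechet_derivative_partial:
  assumes "h differentiable (at p)"
  shows "frechet_derivative h (at p) v = (\<Sum>i\<in>UNIV. v $ i * partial i h p)"
proof -
  have l: "linear (frechet_derivative h (at p))" by (rule linear_frechet_derivative[OF assms])
  have "frechet_derivative h (at p) v = frechet_derivative h (at p) (\<Sum>i\<in>UNIV. v $ i *\<^sub>R axis i 1)"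
    by (metis basis_expansion scalar_mult_eq_scaleR)
  also have "\<dots> = (\<Sum>i\<in>UNIV. v $ i * partial i h p)"
    by (simp add: linear_sum[OF l] linear_scale[OF l] partial_def)
  finally show ?thesis .
qed

text \<open>Links smoothness of a field as a vector-valued map to the componentwise calculus: taking
  a component commutes with differentiation.\<close>

lemma smooth_on_nth_imp_twice_differentiable_on:
  fixes X :: "(real^'n::finite) \<Rightarrow> real^'m"
  assumes "open S" "smooth_on S X"
  shows "twice_differentiable_on S (\<lambda>q. X q $ k)"
proof -
  have "Ck_on 2 S X" using assms by (simp add: smooth_on_def)
  then have 1: "\<And>p. p \<in> S \<Longrightarrow> X differentiable (at p)"
    and 2: "\<And>p v. p \<in> S \<Longrightarrow> (\<lambda>q. frechet_derivative X (at q) v) differentiable (at p)"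
    by (auto simp: numeral_2_eq_2)
  show ?thesis unfolding twice_differentiable_on_def
  proof (intro ballI conjI allI)
    fix p i assume p: "p \<in> S"
    show "(\<lambda>q. X q $ k) differentiable at p" using 1[OF p] differentiable_vec_iff by blast
    have "(\<lambda>q. frechet_derivative X (at q) (axis i 1) $ k) differentiable (at p)"
      using 2[OF p] by (rule differentiable_vec_iff[THEN iffD1, THEN spec])
    then show "partial i (\<lambda>q. X q $ k) differentiable at p"
      by (rule differentiable_transform_open[OF _ assms(1) p]) (simp add: partial_def frechet_derivative_nth 1)
  qed
qed

section \<open>Closure properties of smoothness\<close>

lemma Ck_on_const: "Ck_on k S (\<lambda>p. c)"
  by (induction k arbitrary: c) auto

lemma smooth_on_const: "smooth_on S (\<lambda>p. c)"
  by (simp add: smooth_on_def Ck_on_const)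

text \<open>On an open set, functions that agree also have equal Frechet derivatives, so the
  induction passes to the derivatives; hence it must be general in both functions.\<close>

lemma Ck_on_cong:
  assumes "open S" "\<And>p. p \<in> S \<Longrightarrow> h p = h' p" "Ck_on k S h"
  shows "Ck_on k S h'"
  using assms(2,3)
proof (induction k arbitrary: h h')
  case 0
  then show ?case using continuous_on_cong by force
next
  case (Suc k)
  have "frechet_derivative h (at p) v = frechet_derivative h' (at p) v" if "p \<in> S" for p v
    using frechet_derivative_transform_within_open[of h p S h'] assms(1) Suc.prems that by auto
  then show ?case
    using Suc.prems Suc.IH[of "\<lambda>p. frechet_derivative h (at p) v" "\<lambda>p. frechet_derivative h' (at p) v" for v]
    by (auto intro: differentiable_transform_open[OF _ assms(1)])
qed

text \<open>Serves to show that multiples of \<open>fxx\<close> are admissible coefficients in the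
  \<eta>-Einstein condition.\<close>

lemma Ck_on_scaleR:
  assumes "open S" "Ck_on k S h"
  shows "Ck_on k S (\<lambda>p. c *\<^sub>R h p)"
  using assms(2)
proof (induction k arbitrary: h)
  case 0
  then show ?case by (simp add: continuous_on_scaleR)
next
  case (Suc k)
  have d: "((\<lambda>p. c *\<^sub>R h p) has_derivative (\<lambda>v. c *\<^sub>R frechet_derivative h (at p) v)) (at p)" if "p \<in> S" for p
    using Suc.prems that by (intro has_derivative_scaleR_right) (auto simp flip: frechet_derivative_works)
  then have e: "c *\<^sub>R frechet_derivative h (at p) v = frechet_derivative (\<lambda>p. c *\<^sub>R h p) (at p) v" if "p \<in> S" for p v
    using frechet_derivative_at[OF d[OF that]] by metis
  show ?case
    \<comment> \<open>The scaled derivative and the derivative of the scaled map are known to agree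
      only on \<open>S\<close>, so the induction hypothesis is transported by
      \<open>Ck_on_cong\<close>.\<close>
    using Suc.prems Suc.IH d by (auto intro!: Ck_on_cong[OF assms(1) e] simp: differentiable_def)
qed

lemma smooth_on_partial: "smooth_on S h \<Longrightarrow> smooth_on S (partial i h)"
  unfolding smooth_on_def partial_def[abs_def] by (metis Ck_on.simps(2))

section \<open>Tensoriality of the curvature\<close>

lemma levi_civita_nth:
  assumes "Y differentiable (at p)"
  shows "levi_civita g X Y p $ k =
    (\<Sum>i\<in>UNIV. X p $ i * (partial i (\<lambda>q. Y q $ k) p + (\<Sum>j\<in>UNIV. christoffel g k i j p * Y p $ j)))"
proof -
  have "(\<lambda>q. Y q $ k) differentiable (at p)" using assms differentiable_vec_iff by blast
  then show ?thesis
    unfolding levi_civita_def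
    by (simp add: frechet_derivative_nth[OF assms] frechet_derivative_partial distrib_left sum.distrib
        sum_distrib_left mult_ac)
qed

lemma lie_bracket_nth:
  assumes "X differentiable (at p)" "Y differentiable (at p)"
  shows "lie_bracket X Y p $ k =
    (\<Sum>i\<in>UNIV. X p $ i * partial i (\<lambda>q. Y q $ k) p) - (\<Sum>i\<in>UNIV. Y p $ i * partial i (\<lambda>q. X q $ k) p)"
proof -
  have "(\<lambda>q. X q $ k) differentiable (at p)" "(\<lambda>q. Y q $ k) differentiable (at p)"
    using assms differentiable_vec_iff by blast+
  then show ?thesis
    unfolding lie_bracket_def by (simp add: frechet_derivative_nth assms frechet_derivative_partial)
qed

lemma partial_sum:
  assumes "\<And>j. j \<in> A \<Longrightarrow> h j differentiable (at p)"
  shows "partial i (\<lambda>q. \<Sum>j\<in>A. h j q) p = (\<Sum>j\<in>A. partial i (h j) p)"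
proof -
  have "((\<lambda>q. \<Sum>j\<in>A. h j q) has_derivative (\<lambda>v. \<Sum>j\<in>A. frechet_derivative (h j) (at p) v)) (at p)"
    using assms by (intro has_derivative_sum) (simp flip: frechet_derivative_works)
  from partial_eq[OF this] show ?thesis by (simp add: partial_def)
qed

lemma partial_cong_open:
  assumes "open S" "p \<in> S" "\<And>q. q \<in> S \<Longrightarrow> h q = h' q" "h differentiable (at p)"
  shows "partial i h p = partial i h' p"
  unfolding partial_def using frechet_derivative_transform_within_open[of h p S h'] assms by simp

text \<open>The Leibniz rule splits the iterated derivative in two: a sum with the derivatives of
  \<open>Y\<close>, later cancelled by the Lie bracket term, and a sum that depends on
  \<open>X\<close> and \<open>Y\<close> only through their values at \<open>p\<close>.\<close>

lemma levi_civita_levi_civita_nth: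
  fixes g :: "('n::finite) mfield"
  assumes S: "open S" "p \<in> S"
    and Y: "\<And>k. (\<lambda>q. Y q $ k) differentiable (at p)"
    and Z: "\<And>k. twice_differentiable_on S (\<lambda>q. Z q $ k)"
    and G: "\<And>k i j. christoffel g k i j differentiable (at p)"
  defines "N \<equiv> \<lambda>j l. partial j (\<lambda>q. Z q $ l) p + (\<Sum>k\<in>UNIV. christoffel g l j k p * Z p $ k)"
  shows "levi_civita g X (levi_civita g Y Z) p $ l =
    (\<Sum>i\<in>UNIV. \<Sum>j\<in>UNIV. X p $ i * partial i (\<lambda>q. Y q $ j) p * N j l) +
    (\<Sum>i\<in>UNIV. \<Sum>j\<in>UNIV. X p $ i * Y p $ j *
      (partial i (partial j (\<lambda>q. Z q $ l)) p +
       (\<Sum>k\<in>UNIV. christoffel g l j k p * partial i (\<lambda>q. Z q $ k) p) +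
       (\<Sum>k\<in>UNIV. partial i (christoffel g l j k) p * Z p $ k) +
       (\<Sum>m\<in>UNIV. christoffel g l i m p * N j m)))"
proof -
  define N' where "N' j l q = partial j (\<lambda>q. Z q $ l) q + (\<Sum>k\<in>UNIV. christoffel g l j k q * Z q $ k)" for j l q
  define W where "W l q = (\<Sum>j\<in>UNIV. Y q $ j * N' j l q)" for l q
  have Zd: "Z differentiable (at q)" if "q \<in> S" for q
    using Z that by (auto simp: differentiable_vec_iff[of Z] twice_differentiable_on_def)
  have Zc: "(\<lambda>q. Z q $ k) differentiable (at p)" "partial i (\<lambda>q. Z q $ k) differentiable (at p)" for i k
    using Z S by (auto simp: twice_differentiable_on_def)
  have W: "levi_civita g Y Z q $ l = W l q" if "q \<in> S" for q l
    using levi_civita_nth[OF Zd[OF that]] by (simp add: W_def N'_def)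
  have N'd: "N' j l differentiable (at p)" for j l
    unfolding N'_def[abs_def] by (intro differentiable_add differentiable_sum ballI differentiable_mult Zc G) simp
  have Wd: "W l differentiable (at p)" for l
    unfolding W_def[abs_def] by (intro differentiable_sum ballI differentiable_mult Y N'd) simp
  \<comment> \<open>The inner covariant derivative equals \<open>W\<close> on a neighbourhood of
    \<open>p\<close>, so differentiability carries over.\<close>
  have LCd: "levi_civita g Y Z differentiable (at p)"
    unfolding differentiable_vec_iff[of "levi_civita g Y Z"]
    using differentiable_transform_open[OF Wd S] W by simp
  have pN': "partial i (N' j l) p = partial i (partial j (\<lambda>q. Z q $ l)) p +
       (\<Sum>k\<in>UNIV. christoffel g l j k p * partial i (\<lambda>q. Z q $ k) p) +
       (\<Sum>k\<in>UNIV. partial i (christoffel g l j k) p * Z p $ k)" for i j l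
    unfolding N'_def[abs_def]
    by (simp add: partial_add partial_sum partial_mult Zc G differentiable_mult sum.distrib)
  have pW: "partial i (\<lambda>q. levi_civita g Y Z q $ l) p =
      (\<Sum>j\<in>UNIV. Y p $ j * partial i (N' j l) p + partial i (\<lambda>q. Y q $ j) p * N' j l p)" for i
  proof -
    have "partial i (\<lambda>q. levi_civita g Y Z q $ l) p = partial i (W l) p"
      by (rule partial_cong_open[OF S, symmetric]) (auto simp: W Wd)
    also have "\<dots> = (\<Sum>j\<in>UNIV. Y p $ j * partial i (N' j l) p + partial i (\<lambda>q. Y q $ j) p * N' j l p)"
      unfolding W_def[abs_def] by (simp add: partial_sum partial_mult Y N'd differentiable_mult)
    finally show ?thesis .
  qed
  have N: "N' j l p = N j l" for j l by (simp add: N'_def N_def)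
  have s: "(\<Sum>m\<in>UNIV. christoffel g l i m p * (\<Sum>j\<in>UNIV. Y p $ j * N j m)) =
      (\<Sum>j\<in>UNIV. Y p $ j * (\<Sum>m\<in>UNIV. christoffel g l i m p * N j m))" for i
    by (simp add: sum_distrib_left mult_ac) (rule sum.swap)
  show ?thesis
    unfolding levi_civita_nth[OF LCd] pW W[OF S(2)] W_def N s pN'
    by (simp add: sum_distrib_left sum.distrib distrib_left mult_ac)
qed

lemma curvature_tensorial:
  fixes g :: "('n::finite) mfield"
  assumes S: "open S" "p \<in> S"
    and X: "\<And>k. (\<lambda>q. X q $ k) differentiable (at p)"
    and Y: "\<And>k. (\<lambda>q. Y q $ k) differentiable (at p)"
    and Z: "\<And>k. twice_differentiable_on S (\<lambda>q. Z q $ k)"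
    and G: "\<And>k i j. christoffel g k i j differentiable (at p)"
  shows "curvature g X Y Z p $ l = (\<Sum>i\<in>UNIV. \<Sum>j\<in>UNIV. \<Sum>k\<in>UNIV. X p $ i * Y p $ j * Z p $ k *
    curvature g (coord_field i) (coord_field j) (coord_field k) p $ l)"
proof -
  \<comment> \<open>\<open>N j l\<close> is component \<open>l\<close> of the covariant derivative
    of \<open>Z\<close> along coordinate \<open>j\<close>; \<open>K i j\<close> is component
    \<open>l\<close> of the second one, along \<open>j\<close> first and then
    \<open>i\<close>.\<close>
  define N where "N j l = partial j (\<lambda>q. Z q $ l) p + (\<Sum>k\<in>UNIV. christoffel g l j k p * Z p $ k)" for j l
  define K where "K i j = partial i (partial j (\<lambda>q. Z q $ l)) p +
       (\<Sum>k\<in>UNIV. christoffel g l j k p * partial i (\<lambda>q. Z q $ k) p) +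
       (\<Sum>k\<in>UNIV. partial i (christoffel g l j k) p * Z p $ k) +
       (\<Sum>m\<in>UNIV. christoffel g l i m p * N j m)" for i j
  have Zd: "Z differentiable (at p)"
    using Z S by (auto simp: differentiable_vec_iff[of Z] twice_differentiable_on_def)
  have XYd: "X differentiable (at p)" "Y differentiable (at p)"
    using X Y by (simp_all add: differentiable_vec_iff[of X] differentiable_vec_iff[of Y])
  have XY: "levi_civita g X (levi_civita g Y Z) p $ l =
    (\<Sum>i\<in>UNIV. \<Sum>j\<in>UNIV. X p $ i * partial i (\<lambda>q. Y q $ j) p * N j l) +
    (\<Sum>i\<in>UNIV. \<Sum>j\<in>UNIV. X p $ i * Y p $ j * K i j)"
    unfolding levi_civita_levi_civita_nth[OF S Y Z G] N_def K_def ..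
  have YX: "levi_civita g Y (levi_civita g X Z) p $ l =
    (\<Sum>i\<in>UNIV. \<Sum>j\<in>UNIV. Y p $ i * partial i (\<lambda>q. X q $ j) p * N j l) +
    (\<Sum>i\<in>UNIV. \<Sum>j\<in>UNIV. X p $ i * Y p $ j * K j i)"
  proof -
    have "levi_civita g Y (levi_civita g X Z) p $ l =
      (\<Sum>i\<in>UNIV. \<Sum>j\<in>UNIV. Y p $ i * partial i (\<lambda>q. X q $ j) p * N j l) +
      (\<Sum>i\<in>UNIV. \<Sum>j\<in>UNIV. Y p $ i * X p $ j * K i j)"
      unfolding levi_civita_levi_civita_nth[OF S X Z G] N_def K_def ..
    also have "(\<Sum>i\<in>UNIV. \<Sum>j\<in>UNIV. Y p $ i * X p $ j * K i j) =
      (\<Sum>i\<in>UNIV. \<Sum>j\<in>UNIV. X p $ i * Y p $ j * K j i)"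
      by (subst sum.swap) (simp add: mult_ac)
    finally show ?thesis .
  qed
  have B: "levi_civita g (lie_bracket X Y) Z p $ l =
    (\<Sum>i\<in>UNIV. \<Sum>j\<in>UNIV. X p $ i * partial i (\<lambda>q. Y q $ j) p * N j l) -
    (\<Sum>i\<in>UNIV. \<Sum>j\<in>UNIV. Y p $ i * partial i (\<lambda>q. X q $ j) p * N j l)"
  proof -
    have "levi_civita g (lie_bracket X Y) Z p $ l = (\<Sum>j\<in>UNIV. lie_bracket X Y p $ j * N j l)"
      unfolding levi_civita_nth[OF Zd] N_def ..
    also have "\<dots> = (\<Sum>j\<in>UNIV. \<Sum>i\<in>UNIV. X p $ i * partial i (\<lambda>q. Y q $ j) p * N j l) -
      (\<Sum>j\<in>UNIV. \<Sum>i\<in>UNIV. Y p $ i * partial i (\<lambda>q. X q $ j) p * N j l)"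
      unfolding lie_bracket_nth[OF XYd] by (simp add: left_diff_distrib sum_subtractf sum_distrib_right)
    also have "\<dots> = (\<Sum>i\<in>UNIV. \<Sum>j\<in>UNIV. X p $ i * partial i (\<lambda>q. Y q $ j) p * N j l) -
      (\<Sum>i\<in>UNIV. \<Sum>j\<in>UNIV. Y p $ i * partial i (\<lambda>q. X q $ j) p * N j l)"
      by (intro arg_cong2[where f = "(-)"]) (rule sum.swap)+
    finally show ?thesis .
  qed
  \<comment> \<open>Second derivatives of \<open>Z\<close> cancel by symmetry. Its first derivatives
    enter \<open>K\<close> symmetrically in \<open>i\<close> and \<open>j\<close> and cancel too, so
    only the values of \<open>Z\<close> remain.\<close>
  have K: "K j i - K i j = (\<Sum>k\<in>UNIV. Z p $ k * curvature g (coord_field i) (coord_field j) (coord_field k) p $ l)"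
    for i j
  proof -
    have s: "(\<Sum>m\<in>UNIV. a m * (\<Sum>k\<in>UNIV. Z p $ k * c m k)) = (\<Sum>k\<in>UNIV. Z p $ k * (\<Sum>m\<in>UNIV. a m * c m k))"
      for a :: "'n \<Rightarrow> real" and c
      by (simp add: sum_distrib_left mult_ac) (rule sum.swap)
    show ?thesis
      unfolding K_def N_def curvature_coord[OF G] partial_symmetric[OF S Z, of i j]
      by (simp add: distrib_left right_diff_distrib sum.distrib sum_subtractf sum_negf s mult.commute[of _ "Z p $ _"])
  qed
  have "curvature g X Y Z p $ l = (\<Sum>i\<in>UNIV. \<Sum>j\<in>UNIV. X p $ i * Y p $ j * (K j i - K i j))"
    unfolding curvature_def by (simp add: B XY YX right_diff_distrib sum_subtractf)
  also have "\<dots> = (\<Sum>i\<in>UNIV. \<Sum>j\<in>UNIV. \<Sum>k\<in>UNIV. X p $ i * Y p $ j * Z p $ k *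
    curvature g (coord_field i) (coord_field j) (coord_field k) p $ l)"
    unfolding K by (simp add: sum_distrib_left mult_ac)
  finally show ?thesis .
qed

section \<open>Walker metrics\<close>

lemma christoffel_walker_differentiable:
  assumes f: "f differentiable (at p)" and p: "\<And>i. partial i f differentiable (at p)"
  shows "christoffel (walker_metric f) k i j differentiable (at p)"
proof -
  have C: "christoffel (walker_metric f) k i j = (\<lambda>p. 
   (if k = 1 then (if (i,j) = (1,3) \<or> (i,j) = (3,1) then partial 1 f p / 2
      else if (i,j) = (2,3) \<or> (i,j) = (3,2) then partial 2 f p / 2
      else if (i,j) = (3,3) then (f p * partial 1 f p + partial 3 f p) / 2 else 0)
    else if (i,j) = (3,3) then (if k = 2 then - partial 2 f p / 2 else - partial 1 f p / 2) else 0))"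
    by (rule ext, rule christoffel_walker)
  show ?thesis
    using exhaust_3[of k] exhaust_3[of i] exhaust_3[of j] unfolding C
    by (elim disjE) (simp_all add: f p differentiable_mult differentiable_add differentiable_minus differentiable_divide)
qed

text \<open>Only coordinate planes containing the third direction are curved. Up to the sign from
  swapping \<open>i\<close> and \<open>j\<close>, \<open>(a, b)\<close> is half a row of the Hessian
  of \<open>f\<close> in x, y.\<close>

lemma walker_curvature_coord:
  assumes S: "open S" "p \<in> S" and f: "twice_differentiable_on S f"
  defines "A \<equiv> partial 1 (partial 1 f) p"
    and "B \<equiv> partial 1 (partial 2 f) p"
    and "C \<equiv> partial 2 (partial 2 f) p"
  shows "curvature (walker_metric f) (coord_field i) (coord_field j) (coord_field k) p =
    (if i = j \<or> i \<noteq> 3 \<and> j \<noteq> 3 then 0 else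
     let a = (if i = 1 \<or> j = 1 then A else B) / 2 * (if i = 3 then - 1 else 1);
         b = (if i = 1 \<or> j = 1 then B else C) / 2 * (if i = 3 then - 1 else 1)
     in if k = 1 then vector [- a, 0, 0] else if k = 2 then vector [- b, 0, 0]
        else vector [- f p * a, b, a])"
proof -
  have fd: "f differentiable (at p)" and pd: "\<And>i. partial i f differentiable (at p)"
    using S f by (auto simp: twice_differentiable_on_def)
  \<comment> \<open>Bringing mixed partials into a common order cancels the second derivatives that
    involve z.\<close>
  note sym = partial_symmetric[OF S f]
  have G: "christoffel (walker_metric f) k i j = (\<lambda>p. 
   (if k = 1 then (if (i,j) = (1,3) \<or> (i,j) = (3,1) then partial 1 f p / 2
      else if (i,j) = (2,3) \<or> (i,j) = (3,2) then partial 2 f p / 2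
      else if (i,j) = (3,3) then (f p * partial 1 f p + partial 3 f p) / 2 else 0)
    else if (i,j) = (3,3) then (if k = 2 then - partial 2 f p / 2 else - partial 1 f p / 2) else 0))" for k i j
    by (rule ext, rule christoffel_walker)
  have D: "christoffel (walker_metric f) k i j differentiable (at p)" for k i j
    by (rule christoffel_walker_differentiable[OF fd pd])
  show ?thesis
    unfolding vec_eq_iff forall_3 curvature_coord[OF D] G sum_3 Let_def A_def B_def C_def
    using exhaust_3[of i] exhaust_3[of j] exhaust_3[of k]
    by (elim disjE; clarify)
       (simp_all add: partial_const partial_minus partial_half partial_mult partial_add fd pd
         sym[of 3 1] sym[of 3 2] sym[of 2 1] field_simps)
qed

text \<open>\<open>P\<close> and \<open>R\<close> are the components of the bivector of
  \<open>X\<close> and \<open>Y\<close> on the two curved coordinate planes, and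
  \<open>(a, b)\<close> is half the Hessian in x, y applied to \<open>(P, R)\<close>.\<close>

lemma walker_curvature:
  assumes S: "open S" "p \<in> S" and f: "twice_differentiable_on S f"
    and X: "\<And>k. (\<lambda>q. X q $ k) differentiable (at p)"
    and Y: "\<And>k. (\<lambda>q. Y q $ k) differentiable (at p)"
    and Z: "\<And>k. twice_differentiable_on S (\<lambda>q. Z q $ k)"
  shows "curvature (walker_metric f) X Y Z p =
    (let P = X p $ 1 * Y p $ 3 - X p $ 3 * Y p $ 1;
         R = X p $ 2 * Y p $ 3 - X p $ 3 * Y p $ 2;
         a = (P * partial 1 (partial 1 f) p + R * partial 1 (partial 2 f) p) / 2;
         b = (P * partial 1 (partial 2 f) p + R * partial 2 (partial 2 f) p) / 2
     in vector [- a * Z p $ 1 - b * Z p $ 2 - f p * a * Z p $ 3, b * Z p $ 3, a * Z p $ 3])"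
proof -
  have fd: "f differentiable (at p)" and pd: "\<And>i. partial i f differentiable (at p)"
    using S f by (auto simp: twice_differentiable_on_def)
  show ?thesis
    unfolding vec_eq_iff curvature_tensorial[OF S X Y Z christoffel_walker_differentiable[OF fd pd]]
      walker_curvature_coord[OF S f] Let_def sum_3 forall_3
    by (simp add: field_simps)
qed

section \<open>The pointwise condition\<close>

text \<open>
  Every curvature operator \<open>R(X,Y)\<close> of a Walker metric is determined by a linear combination
  \<open>(a, b)\<close> of \<open>(fxx, fxy)\<close> and \<open>(fxy, fyy)\<close>, and it kills \<open>\<xi>\<close> iff
  \<open>a \<xi>\<^sub>3 = b \<xi>\<^sub>3 = a \<xi>\<^sub>1 + b \<xi>\<^sub>2 = 0\<close>.
\<close>

definition walker_compatible :: "(real^3 \<Rightarrow> real) \<Rightarrow> 3 vfield \<Rightarrow> real^3 \<Rightarrow> bool" where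
  "walker_compatible f \<xi> p \<longleftrightarrow>
    (let fxx = partial 1 (partial 1 f) p; fxy = partial 1 (partial 2 f) p; fyy = partial 2 (partial 2 f) p
     in fxx * \<xi> p $ 3 = 0 \<and> fxy * \<xi> p $ 3 = 0 \<and> fyy * \<xi> p $ 3 = 0 \<and>
        fxx * \<xi> p $ 1 + fxy * \<xi> p $ 2 = 0 \<and> fxy * \<xi> p $ 1 + fyy * \<xi> p $ 2 = 0)"

locale walker =
  fixes M f \<xi>
  assumes pw: "paracontact_walker M f \<xi>"
begin

lemma open_M: "open M" using pw by (simp add: paracontact_walker_def)

lemma twice_f: "twice_differentiable_on M f"
  using pw smooth_on_imp_twice_differentiable_on by (auto simp: paracontact_walker_def)

lemma twice_xi: "twice_differentiable_on M (\<lambda>q. \<xi> q $ k)"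
  using pw smooth_on_imp_twice_differentiable_on by (auto simp: paracontact_walker_def)

lemma unit: "p \<in> M \<Longrightarrow> (\<xi> p $ 2)\<^sup>2 + f p * (\<xi> p $ 3)\<^sup>2 + 2 * \<xi> p $ 1 * \<xi> p $ 3 = 1"
  using pw by (auto simp: paracontact_walker_def)

lemma partials: "p \<in> M \<Longrightarrow> f differentiable (at p)" "p \<in> M \<Longrightarrow> partial i f differentiable (at p)"
  using twice_f by (auto simp: twice_differentiable_on_def)

text \<open>Where \<open>\<xi> p $ 3 = 0\<close>, the normalisation makes \<open>\<xi> p $ 2\<close>
  its own inverse, so the kernel equations can be solved for \<open>fxy\<close> and
  \<open>fyy\<close>. All five converse implications below start from this split.\<close>

lemma compatible_cases:
  assumes "p \<in> M" "walker_compatible f \<xi> p"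
  obtains "partial 1 (partial 1 f) p = 0" "partial 1 (partial 2 f) p = 0" "partial 2 (partial 2 f) p = 0"
  | "\<xi> p $ 3 = 0" "\<xi> p $ 2 = 1 \<or> \<xi> p $ 2 = -1"
    "partial 1 (partial 2 f) p = - partial 1 (partial 1 f) p * \<xi> p $ 1 * \<xi> p $ 2"
    "partial 2 (partial 2 f) p = partial 1 (partial 1 f) p * (\<xi> p $ 1)\<^sup>2"
proof (cases "\<xi> p $ 3 = 0")
  case True
  then have "(\<xi> p $ 2)\<^sup>2 = 1" using unit[OF assms(1)] by simp
  then have "\<xi> p $ 2 = 1 \<or> \<xi> p $ 2 = -1" by (simp add: power2_eq_1_iff)
  with True assms(2) that(2) show ?thesis
    unfolding walker_compatible_def Let_def by (auto simp: power2_eq_square algebra_simps add_eq_0_iff)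
next
  case False
  with assms(2) that(1) show ?thesis
    unfolding walker_compatible_def Let_def by auto
qed

text \<open>The matching split for deriving compatibility: a vanishing Hessian makes all its
  equations trivial, and \<open>\<xi> p $ 3 = 0\<close> leaves the last two.\<close>

lemma compatibleI:
  assumes "p \<in> M"
    and "\<xi> p $ 3 \<noteq> 0 \<Longrightarrow>
      partial 1 (partial 1 f) p = 0 \<and> partial 1 (partial 2 f) p = 0 \<and> partial 2 (partial 2 f) p = 0"
    and "\<xi> p $ 3 = 0 \<Longrightarrow> \<xi> p $ 2 = 1 \<or> \<xi> p $ 2 = -1 \<Longrightarrow>
      partial 1 (partial 1 f) p * \<xi> p $ 1 + partial 1 (partial 2 f) p * \<xi> p $ 2 = 0 \<and>
      partial 1 (partial 2 f) p * \<xi> p $ 1 + partial 2 (partial 2 f) p * \<xi> p $ 2 = 0"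
  shows "walker_compatible f \<xi> p"
proof (cases "\<xi> p $ 3 = 0")
  case True
  then have "(\<xi> p $ 2)\<^sup>2 = 1" using unit[OF assms(1)] by simp
  then have "\<xi> p $ 2 = 1 \<or> \<xi> p $ 2 = -1" by (simp add: power2_eq_1_iff)
  with True assms(3) show ?thesis by (simp add: walker_compatible_def)
next
  case False
  with assms(2) show ?thesis by (simp add: walker_compatible_def)
qed

section \<open>The individual conditions, reduced to \<open>walker_compatible\<close>\<close>

lemmas ricci_walker = walker_ricci[OF partials partial_symmetric[OF open_M _ twice_f]]
lemmas ricci_operator_walker = walker_ricci_operator[OF partials partial_symmetric[OF open_M _ twice_f]]

lemma ricci_operator_commutes_iff:
  "ricci_operator_commutes M (walker_metric f) (walker_phi f \<xi>) \<longleftrightarrow> (\<forall>p\<in>M. walker_compatible f \<xi> p)"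
  unfolding ricci_operator_commutes_def
proof (rule ball_cong[OF refl])
  fix p assume p: "p \<in> M"
  define A B C where "A = partial 1 (partial 1 f) p" and "B = partial 1 (partial 2 f) p"
    and "C = partial 2 (partial 2 f) p"
  let ?C = "ricci_operator (walker_metric f) p ** walker_phi f \<xi> p =
            walker_phi f \<xi> p ** ricci_operator (walker_metric f) p"
  \<comment> \<open>Where \<open>\<xi> p $ 3\<close> is nonzero, the first two equations kill
    \<open>A\<close> and \<open>B\<close>, and the third then kills \<open>C\<close>. Where it is
    zero, the third is one kernel equation and the fourth is twice the other.\<close>
  have e: "?C \<longleftrightarrow> B * \<xi> p $ 3 = 0 \<and> A * \<xi> p $ 3 = 0 \<and>
      A * (\<xi> p $ 1 + f p * \<xi> p $ 3) + C * \<xi> p $ 3 = - B * \<xi> p $ 2 \<and>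
      - B * \<xi> p $ 1 - C * \<xi> p $ 2 = C * \<xi> p $ 2 + B * (\<xi> p $ 1 + f p * \<xi> p $ 3) \<and>
      B * \<xi> p $ 2 = - C * \<xi> p $ 3 - A * \<xi> p $ 1"
    unfolding ricci_operator_walker[OF p p p] Let_def A_def[symmetric] B_def[symmetric] C_def[symmetric]
    by (simp add: vec_eq_iff forall_3 matrix_matrix_mult_def sum_3 walker_phi_def) (auto simp: field_simps)
  show "?C \<longleftrightarrow> walker_compatible f \<xi> p"
  proof
    assume ?C
    then show "walker_compatible f \<xi> p"
      unfolding e
      by (intro compatibleI[OF p]; unfold A_def[symmetric] B_def[symmetric] C_def[symmetric])
        (safe; simp; linarith)+
  next
    assume "walker_compatible f \<xi> p"
    then show ?C
      by (rule compatible_cases[OF p]; unfold e A_def[symmetric] B_def[symmetric] C_def[symmetric])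
        (auto simp: algebra_simps power2_eq_square)
  qed
qed

lemma flat_imp_compatible:
  assumes "flat_on M (walker_metric f)" "p \<in> M"
  shows "walker_compatible f \<xi> p"
proof -
  have "curvature (walker_metric f) (coord_field i) (coord_field j) (coord_field k) p = 0" for i j k
    using assms smooth_on_const[of M] unfolding flat_on_def coord_field_def by blast
  \<comment> \<open>The last two components of these vectors are the halved rows of the Hessian in
    x, y.\<close>
  from this[of 1 3 3] this[of 2 3 3] show ?thesis
    unfolding walker_curvature_coord[OF open_M assms(2) twice_f] by (simp add: vec_eq_iff forall_3 walker_compatible_def)
qed

lemma eta_einstein_iff:
  "eta_einstein M (walker_metric f) (walker_eta f \<xi>) \<longleftrightarrow> (\<forall>p\<in>M. walker_compatible f \<xi> p)"
proof
  assume "eta_einstein M (walker_metric f) (walker_eta f \<xi>)"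
  then obtain a b where ab: "\<And>p. p \<in> M \<Longrightarrow> ricci (walker_metric f) p =
      a p *\<^sub>R walker_metric f p + b p *\<^sub>R (\<chi> i j. walker_eta f \<xi> p $ i * walker_eta f \<xi> p $ j)"
    unfolding eta_einstein_def by blast
  show "\<forall>p\<in>M. walker_compatible f \<xi> p"
  proof
    fix p assume p: "p \<in> M"
    \<comment> \<open>Where \<open>\<xi> p $ 3\<close> is nonzero, entry (1,1) gives
      \<open>b p = 0\<close> and entry (2,2) gives \<open>a p = 0\<close>, so the Ricci tensor
      vanishes. Elsewhere entry (2,2) gives \<open>a p = - b p\<close>, and the third column
      determines the Hessian.\<close>
    show "walker_compatible f \<xi> p"
      using ab[OF p] unfolding ricci_walker[OF p p p] Let_def vec_eq_iff forall_3 walker_metric_def walker_eta_def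
      by (intro compatibleI[OF p], auto simp: field_simps, algebra+)
  qed
next
  assume c: "\<forall>p\<in>M. walker_compatible f \<xi> p"
  \<comment> \<open>The functions \<open>a = fxx/2\<close> and \<open>b = - fxx/2\<close> also serve at the points where the Ricci
    tensor vanishes, so nothing has to be patched together.\<close>
  have s: "smooth_on M (\<lambda>p. c *\<^sub>R partial 1 (partial 1 f) p)" for c :: real
    using pw smooth_on_partial[of M "partial 1 f" 1] smooth_on_partial[of M f 1] Ck_on_scaleR[OF open_M]
    unfolding paracontact_walker_def smooth_on_def by blast
  show "eta_einstein M (walker_metric f) (walker_eta f \<xi>)"
    unfolding eta_einstein_def
  proof (intro exI conjI ballI)
    fix p assume p: "p \<in> M"
    show "ricci (walker_metric f) p = ((1/2) *\<^sub>R partial 1 (partial 1 f) p) *\<^sub>R walker_metric f p +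
        ((-1/2) *\<^sub>R partial 1 (partial 1 f) p) *\<^sub>R (\<chi> i j. walker_eta f \<xi> p $ i * walker_eta f \<xi> p $ j)"
      by (rule compatible_cases[OF p c[rule_format, OF p]])
        (auto simp: ricci_walker[OF p p p] Let_def vec_eq_iff forall_3 walker_metric_def walker_eta_def
          field_simps power2_eq_square)
  qed (rule s)+
qed

text \<open>Makes \<phi>Z an admissible argument of \<open>walker_curvature\<close>, so that the
  curvature of \<phi>Z depends only on its value at \<open>p\<close>.\<close>

lemma twice_differentiable_on_phi:
  assumes "\<And>k. twice_differentiable_on M (\<lambda>q. Z q $ k)"
  shows "twice_differentiable_on M (\<lambda>q. (walker_phi f \<xi> q *v Z q) $ k)"
proof -
  have "twice_differentiable_on M (\<lambda>q. walker_phi f \<xi> q $ i $ j)" for i j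
    using exhaust_3[of i] exhaust_3[of j] unfolding walker_phi_def
    by (elim disjE) (auto intro!: open_M twice_f twice_xi twice_differentiable_on_add twice_differentiable_on_mult
        twice_differentiable_on_uminus twice_differentiable_on_const)
  then show ?thesis
    unfolding matrix_vector_mult_def
    by (auto intro!: open_M assms twice_differentiable_on_sum twice_differentiable_on_mult)
qed

lemma smooth_components:
  fixes X :: "3 vfield"
  assumes "smooth_on M X"
  shows "twice_differentiable_on M (\<lambda>q. X q $ k)"
    and "p \<in> M \<Longrightarrow> (\<lambda>q. X q $ k) differentiable (at p)"
  using smooth_on_nth_imp_twice_differentiable_on[OF open_M assms, of k] by (auto simp: twice_differentiable_on_def)

lemma kaehler_curvature_iff:
  "kaehler_curvature M (walker_metric f) (walker_phi f \<xi>) \<longleftrightarrow> (\<forall>p\<in>M. walker_compatible f \<xi> p)"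
proof (intro iffI ballI)
  fix p assume k: "kaehler_curvature M (walker_metric f) (walker_phi f \<xi>)" and p: "p \<in> M"
  have E: "curvature (walker_metric f) (coord_field i) (coord_field j) (\<lambda>q. walker_phi f \<xi> q *v coord_field k q) p =
    walker_phi f \<xi> p *v curvature (walker_metric f) (coord_field i) (coord_field j) (coord_field k) p" for i j k
    using k p smooth_on_const[of M] unfolding kaehler_curvature_def coord_field_def by blast
  have sc: "smooth_on M (coord_field i)" for i :: 3 unfolding coord_field_def by (rule smooth_on_const)
  note sc' = smooth_components[OF sc]
  note W = walker_curvature[OF open_M p twice_f sc'(2)[OF p] sc'(2)[OF p]]
  note E' = E[unfolded W[OF twice_differentiable_on_phi, OF sc'(1)] walker_curvature_coord[OF open_M p twice_f]]
  \<comment> \<open>With \<open>(a, b)\<close> as in \<open>walker_curvature_coord\<close>, the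
    first coordinate vector gives \<open>a * \<xi> p $ 3 = 0\<close> and
    \<open>b * \<xi> p $ 3 = 0\<close>, and the second gives
    \<open>a * \<xi> p $ 1 + b * \<xi> p $ 2 = 0\<close>.\<close>
  from E'[of 1 3 1] E'[of 1 3 2] E'[of 2 3 1] E'[of 2 3 2] E'[of 1 3 3] E'[of 2 3 3]
  show "walker_compatible f \<xi> p"
    unfolding Let_def vec_eq_iff forall_3 matrix_vector_mult_def sum_3 walker_phi_def coord_field_def
    by (intro compatibleI[OF p]) (auto simp: field_simps axis_def)
next
  assume c: "\<forall>p\<in>M. walker_compatible f \<xi> p"
  show "kaehler_curvature M (walker_metric f) (walker_phi f \<xi>)"
    unfolding kaehler_curvature_def
  proof (intro allI impI ballI)
    fix X Y Z :: "3 vfield" and p assume s: "smooth_on M X" "smooth_on M Y" "smooth_on M Z" and p: "p \<in> M"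
    note W = walker_curvature[OF open_M p twice_f smooth_components(2)[OF s(1) p] smooth_components(2)[OF s(2) p]]
    show "curvature (walker_metric f) X Y (\<lambda>q. walker_phi f \<xi> q *v Z q) p =
      walker_phi f \<xi> p *v curvature (walker_metric f) X Y Z p"
      unfolding W[OF twice_differentiable_on_phi, OF smooth_components(1)[OF s(3)]] W[OF smooth_components(1)[OF s(3)]]
      by (rule compatible_cases[OF p c[rule_format, OF p]])
        (auto simp: Let_def vec_eq_iff forall_3 matrix_vector_mult_def sum_3 walker_phi_def field_simps power2_eq_square)
  qed
qed

lemma ricci_anti_invariant_iff:
  "ricci_anti_invariant M (walker_metric f) (walker_phi f \<xi>) \<longleftrightarrow> (\<forall>p\<in>M. walker_compatible f \<xi> p)"
proof (intro iffI ballI)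
  fix p assume k: "ricci_anti_invariant M (walker_metric f) (walker_phi f \<xi>)" and p: "p \<in> M"
  have E: "inner_of (ricci (walker_metric f) p) (walker_phi f \<xi> p *v axis i 1) (walker_phi f \<xi> p *v axis j 1) =
    - inner_of (ricci (walker_metric f) p) (axis i 1) (axis j 1)" for i j
    using k p smooth_on_const[of M] unfolding ricci_anti_invariant_def by blast
  \<comment> \<open>Where \<open>\<xi> p $ 3\<close> is nonzero, (1,2) and (1,3) give
    \<open>fxx = 0\<close>, then (1,2) gives \<open>fxy = 0\<close> and (2,2) gives
    \<open>fyy = 0\<close>. Where it is zero, (2,3) yields \<open>fxy\<close> and (3,3) yields
    \<open>fyy\<close>.\<close>
  from E[of 1 2] E[of 2 2] E[of 1 3] E[of 2 3] E[of 3 3]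
  show "walker_compatible f \<xi> p"
    unfolding ricci_walker[OF p p p] Let_def matrix_vector_mult_def sum_3 walker_phi_def inner_of_def inner_vec_def
    by (intro compatibleI[OF p]) (auto simp: field_simps axis_def)
next
  assume c: "\<forall>p\<in>M. walker_compatible f \<xi> p"
  show "ricci_anti_invariant M (walker_metric f) (walker_phi f \<xi>)"
    unfolding ricci_anti_invariant_def
  proof (intro allI impI ballI)
    fix X Y :: "3 vfield" and p assume p: "p \<in> M"
    show "inner_of (ricci (walker_metric f) p) (walker_phi f \<xi> p *v X p) (walker_phi f \<xi> p *v Y p) =
      - inner_of (ricci (walker_metric f) p) (X p) (Y p)"
      by (rule compatible_cases[OF p c[rule_format, OF p]])
        (auto simp: ricci_walker[OF p p p] Let_def matrix_vector_mult_def sum_3 walker_phi_def inner_of_def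
          inner_vec_def field_simps power2_eq_square)
  qed
qed

lemma curvature_annihilates_iff:
  "curvature_annihilates M (walker_metric f) \<xi> \<longleftrightarrow> (\<forall>p\<in>M. walker_compatible f \<xi> p)"
proof (intro iffI ballI)
  fix p assume k: "curvature_annihilates M (walker_metric f) \<xi>" and p: "p \<in> M"
  have sc: "smooth_on M (coord_field i)" for i :: 3 unfolding coord_field_def by (rule smooth_on_const)
  note W = walker_curvature[OF open_M p twice_f smooth_components(2)[OF sc p] smooth_components(2)[OF sc p] twice_xi]
  have E: "curvature (walker_metric f) (coord_field i) (coord_field j) \<xi> p = 0" for i j
    using k p sc unfolding curvature_annihilates_def by blast
  \<comment> \<open>The two curved coordinate planes supply both rows of the Hessian.\<close>
  from E[of 1 3] E[of 2 3] show "walker_compatible f \<xi> p"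
    unfolding W unfolding Let_def vec_eq_iff forall_3 coord_field_def
    by (intro compatibleI[OF p]) (auto simp: field_simps axis_def)
next
  assume c: "\<forall>p\<in>M. walker_compatible f \<xi> p"
  show "curvature_annihilates M (walker_metric f) \<xi>"
    unfolding curvature_annihilates_def
  proof (intro allI impI ballI)
    fix X Y :: "3 vfield" and p assume s: "smooth_on M X" "smooth_on M Y" and p: "p \<in> M"
    show "curvature (walker_metric f) X Y \<xi> p = 0"
      unfolding walker_curvature[OF open_M p twice_f smooth_components(2)[OF s(1) p] smooth_components(2)[OF s(2) p] twice_xi]
      by (rule compatible_cases[OF p c[rule_format, OF p]])
        (auto simp: Let_def vec_eq_iff forall_3 field_simps power2_eq_square)
  qed
qed

end

theorem theorem5p2:
  fixes M :: "(real^3) set" and f :: "real^3 \<Rightarrow> real" and \<xi> :: "real^3 \<Rightarrow> real^3"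
  assumes "paracontact_walker M f \<xi>"
  shows "let g = walker_metric f; \<phi> = walker_phi f \<xi>; \<eta> = walker_eta f \<xi> in
    (ricci_operator_commutes M g \<phi> \<longleftrightarrow> (flat_on M g \<or> eta_einstein M g \<eta>)) \<and>
    ((flat_on M g \<or> eta_einstein M g \<eta>) \<longleftrightarrow> kaehler_curvature M g \<phi>) \<and>
    (kaehler_curvature M g \<phi> \<longleftrightarrow> ricci_anti_invariant M g \<phi>) \<and>
    (ricci_anti_invariant M g \<phi> \<longleftrightarrow> curvature_annihilates M g \<xi>)"
proof -
  interpret walker M f \<xi> by unfold_locales (rule assms)
  show ?thesis
    \<comment> \<open>Flatness implies compatibility, which is equivalent to the \<eta>-Einstein
      condition; the disjunction in (ii) thus collapses to its second member.\<close>
    using flat_imp_compatible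
    unfolding Let_def ricci_operator_commutes_iff eta_einstein_iff kaehler_curvature_iff
      ricci_anti_invariant_iff curvature_annihilates_iff
    by blast
qed

end
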